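(* Let $\rho>0$. For all $x\in\mathbb{R}^n$ with $\|x\|_\infty\le\sqrt{2/\rho}$, it holds that $0\in\mathrm{prox}_{\frac1\rho h_2}(x)$.
   Context: $h_2(u)=\left(\|u\|_1/\|u\|_2\right)^2$ for $u\in\mathbb{R}^n\setminus\{0\}$ and $h_2(0)=0$. $\mathrm{prox}_{\frac1\rho h_2}(x)$ is the set of all minimizers over $u\in\mathbb{R}^n$ of $\frac{\rho}{2}\|u-x\|_2^2+h_2(u)$. *)

theory Defs
  imports "HOL-Analysis.Analysis"
begin

definition l1_norm :: "real ^ 'n \<Rightarrow> real" where
  "l1_norm u = (\<Sum>i\<in>UNIV. \<bar>u $ i\<bar>)"

definition h2 :: "real ^ 'n \<Rightarrow> real" where
  "h2 u = (if u = 0 then 0 else (l1_norm u / norm u)\<^sup>2)"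

(* The set written prox_{(1/\<rho>) h}(x): the parameter \<rho> multiplies the quadratic
   term and h is left unscaled. *)
definition prox :: "real \<Rightarrow> (real ^ 'n \<Rightarrow> real) \<Rightarrow> real ^ 'n \<Rightarrow> (real ^ 'n) set" where
  "prox \<rho> h x = {u. is_arg_min (\<lambda>v. \<rho> / 2 * (norm (v - x))\<^sup>2 + h v) (\<lambda>v. v \<in> UNIV) u}"

end

theory Submission
  imports Defs
begin

text \<open>
  Expanding the square, the claim for nonzero \<open>u\<close> is
  \<open>\<rho> (u \<bullet> x) \<le> \<rho>/2 \<parallel>u\<parallel>\<^sub>2\<^sup>2 + \<parallel>u\<parallel>\<^sub>1\<^sup>2 / \<parallel>u\<parallel>\<^sub>2\<^sup>2\<close>. By Hoelder and the bound on \<open>x\<close>, the left-hand side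
  is at most \<open>\<surd>(2\<rho>) \<parallel>u\<parallel>\<^sub>1\<close>, and by AM-GM the right-hand side is at least that.
\<close>

lemma inner_le_l1_norm_infnorm: "u \<bullet> x \<le> l1_norm u * infnorm x"
proof -
  have "u $ i * x $ i \<le> \<bar>u $ i\<bar> * infnorm x" for i
  proof -
    have "u $ i * x $ i \<le> \<bar>u $ i\<bar> * \<bar>x $ i\<bar>"
      by (metis abs_ge_self abs_mult)
    also have "\<dots> \<le> \<bar>u $ i\<bar> * infnorm x"
      by (intro mult_left_mono component_le_infnorm_cart) simp
    finally show ?thesis .
  qed
  then show ?thesis
    by (simp add: inner_vec_def l1_norm_def sum_distrib_right sum_mono)
qed

theorem theorem3p10:
  fixes \<rho> :: real and x :: "real ^ 'n"
  assumes "\<rho> > 0"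
    and "infnorm x \<le> sqrt (2 / \<rho>)"
  shows "0 \<in> prox \<rho> h2 x"
proof -
  \<comment> \<open>The left-hand side is the objective at \<open>0\<close>, because
    \<open>h2 0 = 0\<close>.\<close>
  have "\<rho> / 2 * (norm x)\<^sup>2 \<le> \<rho> / 2 * (norm (u - x))\<^sup>2 + h2 u" for u
  proof (cases "u = 0")
    case True
    then show ?thesis by (simp add: h2_def)
  next
    case False
    \<comment> \<open>Chosen so that the quadratic term becomes the square of
      \<open>k * norm u\<close>, while the bound on \<open>infnorm x\<close> becomes
      \<open>1 / k\<close>.\<close>
    define k where "k = sqrt (\<rho> / 2)"
    have "k > 0" and k2: "\<rho> = 2 * k\<^sup>2" and k_inv: "sqrt (2 / \<rho>) = 1 / k"
      using \<open>\<rho> > 0\<close> by (auto simp: k_def real_sqrt_divide power_divide)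
    have l1_nonneg: "0 \<le> l1_norm u"
      by (simp add: l1_norm_def sum_nonneg)
    have "u \<bullet> x \<le> l1_norm u * infnorm x"
      by (rule inner_le_l1_norm_infnorm)
    also have "\<dots> \<le> l1_norm u * (1 / k)"
      using assms(2) l1_nonneg by (intro mult_left_mono) (simp_all add: k_inv)
    finally have "\<rho> * (u \<bullet> x) \<le> \<rho> * (l1_norm u * (1 / k))"
      using \<open>\<rho> > 0\<close> by (intro mult_left_mono) simp_all
    \<comment> \<open>Inserting and cancelling \<open>norm u\<close> splits the bound into twice the
      product of the two quantities whose squares form the target sum.\<close>
    also have "\<dots> = 2 * (k * norm u) * (l1_norm u / norm u)"
      using \<open>k > 0\<close> False by (simp add: k2 power2_eq_square)
    also have "\<dots> \<le> (k * norm u)\<^sup>2 + (l1_norm u / norm u)\<^sup>2"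
      by (rule sum_squares_bound)
    also have "\<dots> = \<rho> / 2 * (norm u)\<^sup>2 + h2 u"
      using False by (simp add: h2_def k2 power_mult_distrib)
    finally have "\<rho> * (u \<bullet> x) \<le> \<rho> / 2 * (norm u)\<^sup>2 + h2 u" .
    moreover have "\<rho> / 2 * (norm (u - x))\<^sup>2 = \<rho> / 2 * (norm u)\<^sup>2 - \<rho> * (u \<bullet> x) + \<rho> / 2 * (norm x)\<^sup>2"
      by (simp add: power2_norm_eq_inner inner_diff inner_commute field_simps)
    ultimately show ?thesis
      by linarith
  qed
  then show ?thesis
    by (auto simp: prox_def is_arg_min_def h2_def not_less)
qed

end
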